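(* Let $H$ be a complex Hilbert space and let $A \in B(H)$ be supraposinormal with interrupter pair $(Q,P)$; that is, $P, Q \in B(H)$ are positive operators, at least one of which has dense range, and $AQA^* = A^*PA$. Let $D \in B(H)$ be a positive operator. (i) If there exist constants $\delta_1, \delta_2 > 0$ such that $\delta_1 Q \geq D \geq \delta_2 P \geq 0$, then $\sqrt{D}A\sqrt{D}$ is posinormal. (ii) If there exist constants $\delta_1, \delta_2 > 0$ with $\delta_1 \leq \delta_2$ such that $\delta_1 Q \geq D \geq \delta_2 P \geq 0$, then $\sqrt{D}A\sqrt{D}$ is hyponormal.
   Context: $B(H)$ denotes the bounded linear operators on $H$. "Positive" means positive semidefinite: $\langle Tf,f\rangle \geq 0$ for all $f \in H$; $S \geq T$ means $S-T$ is positive; $\sqrt{D}$ is the positive square root of $D$. An operator $T \in B(H)$ is posinormal if there exists a positive operator $R \in B(H)$ with $TT^* = T^*RT$; equivalently, $\gamma^2 T^*T \geq TT^*$ for some $\gamma \geq 0$. $T$ is hyponormal if $T^*T \geq TT^*$. $T \in B(H)$ is supraposinormal if there exist positive operators $P,Q \in B(H)$, at least one of which has dense range, such that $TQT^* = T^*PT$; then $(Q,P)$ is called an interrupter pair associated with $T$. *)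

theory Defs
  imports "HOL-Analysis.Analysis"
begin

text \<open>
  Complex vector spaces, inner product spaces and Hilbert spaces as type classes on top of
  the real hierarchy of the library. A complex Hilbert space is in particular a real one, with
  real inner product \<open>Re \<langle>x, y\<rangle>\<close> and the same norm; extending \<^class>\<open>real_inner\<close> with
  this compatibility requirement is therefore no restriction. It provides the norm, which
  satisfies \<open>norm x = sqrt (Re \<langle>x, x\<rangle>)\<close>, and positive definiteness of the inner product.
\<close>

class complex_vector = real_vector +
  fixes scaleC :: "complex \<Rightarrow> 'a \<Rightarrow> 'a" (infixr "*\<^sub>C" 75)
  assumes scaleC_add_right: "a *\<^sub>C (x + y) = a *\<^sub>C x + a *\<^sub>C y"
    and scaleC_add_left: "(a + b) *\<^sub>C x = a *\<^sub>C x + b *\<^sub>C x"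
    and scaleC_scaleC: "a *\<^sub>C b *\<^sub>C x = (a * b) *\<^sub>C x"
    and scaleC_one: "1 *\<^sub>C x = x"
    and scaleR_scaleC: "r *\<^sub>R x = complex_of_real r *\<^sub>C x"

text \<open>The inner product is linear in the first and conjugate-linear in the second argument.\<close>

class complex_inner = real_inner + complex_vector +
  fixes cinner :: "'a \<Rightarrow> 'a \<Rightarrow> complex"
  assumes cinner_add_left: "cinner (x + y) z = cinner x z + cinner y z"
    and cinner_scaleC_left: "cinner (a *\<^sub>C x) y = a * cinner x y"
    and cinner_commute: "cinner x y = cnj (cinner y x)"
    and inner_eq_Re_cinner: "x \<bullet> y = Re (cinner x y)"

class chilbert_space = complex_inner + complete_space

definition bounded_clinear :: "('a::complex_inner \<Rightarrow> 'b::complex_inner) \<Rightarrow> bool" where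
  "bounded_clinear T \<longleftrightarrow> bounded_linear T \<and> (\<forall>c x. T (c *\<^sub>C x) = c *\<^sub>C T x)"

text \<open>On \<^class>\<open>chilbert_space\<close>, every bounded operator has exactly one adjoint.\<close>

definition cadjoint :: "('a::chilbert_space \<Rightarrow> 'a) \<Rightarrow> 'a \<Rightarrow> 'a" where
  "cadjoint T = (THE S. \<forall>x y. cinner (T x) y = cinner x (S y))"

definition positive_op :: "('a::chilbert_space \<Rightarrow> 'a) \<Rightarrow> bool" where
  "positive_op T \<longleftrightarrow> bounded_clinear T \<and> (\<forall>f. cinner (T f) f \<in> \<real>\<^sub>\<ge>\<^sub>0)"

definition op_ge :: "('a::chilbert_space \<Rightarrow> 'a) \<Rightarrow> ('a \<Rightarrow> 'a) \<Rightarrow> bool" (infix "\<succeq>" 50) where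
  "S \<succeq> T \<longleftrightarrow> positive_op (\<lambda>f. S f - T f)"

text \<open>Every positive operator has exactly one positive square root.\<close>

definition op_sqrt :: "('a::chilbert_space \<Rightarrow> 'a) \<Rightarrow> 'a \<Rightarrow> 'a" where
  "op_sqrt D = (THE S. positive_op S \<and> S \<circ> S = D)"

definition posinormal :: "('a::chilbert_space \<Rightarrow> 'a) \<Rightarrow> bool" where
  "posinormal T \<longleftrightarrow> bounded_clinear T \<and>
     (\<exists>R. positive_op R \<and> T \<circ> cadjoint T = cadjoint T \<circ> R \<circ> T)"

definition hyponormal :: "('a::chilbert_space \<Rightarrow> 'a) \<Rightarrow> bool" where
  "hyponormal T \<longleftrightarrow> bounded_clinear T \<and> cadjoint T \<circ> T \<succeq> T \<circ> cadjoint T"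

definition dense_range :: "('a::chilbert_space \<Rightarrow> 'a) \<Rightarrow> bool" where
  "dense_range T \<longleftrightarrow> closure (range T) = UNIV"

definition interrupter_pair ::
  "('a::chilbert_space \<Rightarrow> 'a) \<Rightarrow> ('a \<Rightarrow> 'a) \<Rightarrow> ('a \<Rightarrow> 'a) \<Rightarrow> bool" where
  "interrupter_pair T Q P \<longleftrightarrow> positive_op Q \<and> positive_op P \<and>
     (dense_range Q \<or> dense_range P) \<and> T \<circ> Q \<circ> cadjoint T = cadjoint T \<circ> P \<circ> T"

definition supraposinormal :: "('a::chilbert_space \<Rightarrow> 'a) \<Rightarrow> bool" where
  "supraposinormal T \<longleftrightarrow> bounded_clinear T \<and> (\<exists>Q P. interrupter_pair T Q P)"

end

theory Submission
  imports Defs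
begin

text \<open>
  Put \<open>B = \<surd>D\<close> and \<open>T = B A B\<close>, so that \<open>T* = B A* B\<close>. With \<open>g = B f\<close>,
  \<open>\<parallel>T* f\<parallel>\<^sup>2 = \<langle>D A* g, A* g\<rangle> \<le> \<delta>\<^sub>1 \<langle>A Q A* g, g\<rangle> = \<delta>\<^sub>1 \<langle>P A g, A g\<rangle>
  \<le> (\<delta>\<^sub>1 / \<delta>\<^sub>2) \<langle>D A g, A g\<rangle> = (\<delta>\<^sub>1 / \<delta>\<^sub>2) \<parallel>T f\<parallel>\<^sup>2\<close>.
  If \<open>\<delta>\<^sub>1 \<le> \<delta>\<^sub>2\<close>, this is hyponormality. In general it is the hypothesis of Douglas' lemma,
  which gives a bounded \<open>S\<close> with \<open>T* S = T\<close>; then \<open>T T* = T* (S S*) T\<close>.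

  Adjoints and the operator \<open>S\<close> both come from one variant of the Riesz representation theorem,
  applied to functionals that are bounded by the seminorm \<open>f \<mapsto> \<parallel>T f\<parallel>\<close>. The square root of an
  operator \<open>1 - A\<close> with \<open>A\<close> a contraction is the binomial series of \<open>\<surd>(1 - x)\<close> at \<open>A\<close>, which
  converges absolutely. Everything is done for the real inner product and transferred to the complex
  one by commutation with scalars.
\<close>

instance chilbert_space \<subseteq> banach ..

text \<open>Near \<open>t = 0\<close> the linear term dominates, so a nonzero \<open>b\<close> would
  make the expression negative on one side of 0. This is the first-order condition at a minimum, for
  \<open>c\<close> of either sign.\<close>

lemma linear_coeff_eq_0_if_quadratic_nonneg: fixes b c :: real
  assumes "\<And>t. 0 \<le> 2 * t * b + t\<^sup>2 * c"
  shows "b = 0"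
proof (rule ccontr)
  assume "b \<noteq> 0"
  (* nearly the minimizer \<open>- b / c\<close>, but defined for every \<open>c\<close> *)
  define t where "t = - b / (\<bar>c\<bar> + 1)"
  have "0 \<le> 2 * t * b + t\<^sup>2 * c" by (rule assms)
  also have "t\<^sup>2 * c \<le> t\<^sup>2 * (\<bar>c\<bar> + 1)" by (intro mult_left_mono) auto
  also have "2 * t * b + t\<^sup>2 * (\<bar>c\<bar> + 1) = - (b\<^sup>2 / (\<bar>c\<bar> + 1))"
    unfolding t_def by (simp add: power2_eq_square divide_simps)
  also have "\<dots> < 0" using \<open>b \<noteq> 0\<close> by (simp add: divide_pos_pos add_nonneg_pos)
  finally show False by simp
qed

section \<open>Riesz representation\<close>

text \<open>The minimizing sequence \<open>f n\<close> of \<open>\<parallel>T f\<parallel>\<^sup>2 - 2 \<phi> f\<close> need not converge, but \<open>T (f n)\<close> does.\<close>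

lemma riesz_along_linear_map:
  fixes T :: "'b::real_vector \<Rightarrow> 'a::{real_inner,banach}"
  assumes T: "linear T" and \<phi>: "linear \<phi>" and K: "\<And>f. \<bar>\<phi> f\<bar> \<le> K * norm (T f)" and "0 \<le> K"
  obtains y where "y \<in> closure (range T)" "\<And>f. T f \<bullet> y = \<phi> f" "norm y \<le> K"
proof -
  define J where "J f = (norm (T f))\<^sup>2 - 2 * \<phi> f" for f
  have Jlow: "- K\<^sup>2 \<le> J f" for f
  proof -
    have "0 \<le> (norm (T f) - K)\<^sup>2" by simp
    then show ?thesis using K[of f] unfolding J_def power2_diff by (simp add: mult.commute)
  qed
  define m where "m = Inf (range J)"
  have mle: "m \<le> J f" for f
    unfolding m_def using Jlow by (intro cInf_lower bdd_belowI2[where m = "- K\<^sup>2"]) auto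
  have "\<exists>f. J f < m + 1 / Suc n" for n
    using cInf_lessD[of "range J" "m + 1 / Suc n"] by (auto simp: m_def)
  then obtain f where f: "\<And>n. J (f n) < m + 1 / Suc n" by metis
  \<comment> \<open>Parallelogram law: the linear terms of \<open>J\<close> cancel and the midpoint
    has value at least \<open>m\<close>, so nearly minimal points have nearby images under
    \<open>T\<close>.\<close>
  have par: "(norm (T g - T h))\<^sup>2 \<le> 2 * (J g - m) + 2 * (J h - m)" for g h
  proof -
    have "(norm (T g - T h))\<^sup>2 = 2 * J g + 2 * J h - 4 * J ((1/2) *\<^sub>R (g + h))"
      unfolding J_def linear_scale[OF T] linear_add[OF T] linear_scale[OF \<phi>] linear_add[OF \<phi>]
      by (simp add: power2_norm_eq_inner inner_simps inner_commute algebra_simps)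
    then show ?thesis using mle[of "(1/2) *\<^sub>R (g + h)"] by simp
  qed
  have "Cauchy (\<lambda>n. T (f n))"
  proof (rule metric_CauchyI)
    fix e :: real assume "e > 0"
    \<comment> \<open>In \<open>par\<close> two defects enter with factor 2 each; keeping both below
      \<open>e\<^sup>2 / 4\<close> gives \<open>e\<^sup>2\<close>.\<close>
    then have "e\<^sup>2 / 4 > 0" by simp
    then obtain N where N: "1 / Suc N < e\<^sup>2 / 4" using nat_approx_posE by blast
    have "dist (T (f i)) (T (f j)) < e" if "i \<ge> N" "j \<ge> N" for i j
    proof -
      have J: "J (f k) - m < e\<^sup>2 / 4" if "k \<ge> N" for k
      proof -
        have "1 / real (Suc k) \<le> 1 / Suc N" using that by (intro divide_left_mono) auto
        then show ?thesis using f[of k] N by linarith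
      qed
      have "(norm (T (f i) - T (f j)))\<^sup>2 < e\<^sup>2"
        using par[of "f i" "f j"] J[OF that(1)] J[OF that(2)] by argo
      then show ?thesis using \<open>e > 0\<close> by (simp add: dist_norm power2_less_imp_less)
    qed
    then show "\<exists>M. \<forall>m\<ge>M. \<forall>n\<ge>M. dist (T (f m)) (T (f n)) < e" by blast
  qed
  then obtain y where y: "(\<lambda>n. T (f n)) \<longlonglongrightarrow> y"
    using Cauchy_convergent convergent_def by blast
  have eq: "T h \<bullet> y = \<phi> h" for h
  proof -
    \<comment> \<open>First variation of \<open>J\<close> in direction \<open>h\<close>, taken along
      the sequence \<open>f n\<close> instead of at a minimizer. The defect of \<open>f n\<close> is
      below \<open>1 / Suc n\<close> and vanishes in the limit.\<close>
    have "0 \<le> 2 * t * (y \<bullet> T h - \<phi> h) + t\<^sup>2 * (T h \<bullet> T h)" for t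
    proof -
      have ge: "0 \<le> 1 / Suc n + 2 * t * (T (f n) \<bullet> T h - \<phi> h) + t\<^sup>2 * (T h \<bullet> T h)" for n
      proof -
        have "J (f n + t *\<^sub>R h) = J (f n) + 2 * t * (T (f n) \<bullet> T h - \<phi> h) + t\<^sup>2 * (T h \<bullet> T h)"
          unfolding J_def linear_scale[OF T] linear_add[OF T] linear_scale[OF \<phi>] linear_add[OF \<phi>]
          by (simp add: power2_norm_eq_inner inner_simps inner_commute algebra_simps power2_eq_square[of t])
        then show ?thesis using mle[of "f n + t *\<^sub>R h"] f[of n] by linarith
      qed
      have lim: "(\<lambda>n. 1 / Suc n + 2 * t * (T (f n) \<bullet> T h - \<phi> h) + t\<^sup>2 * (T h \<bullet> T h))
          \<longlonglongrightarrow> 0 + 2 * t * (y \<bullet> T h - \<phi> h) + t\<^sup>2 * (T h \<bullet> T h)"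
        using LIMSEQ_inverse_real_of_nat
        by (intro tendsto_intros y) (simp add: inverse_eq_divide)
      have "0 \<le> 0 + 2 * t * (y \<bullet> T h - \<phi> h) + t\<^sup>2 * (T h \<bullet> T h)"
        using ge by (intro LIMSEQ_le_const[OF lim] exI[of _ 0]) blast
      then show ?thesis by simp
    qed
    then have "y \<bullet> T h - \<phi> h = 0" by (rule linear_coeff_eq_0_if_quadratic_nonneg)
    then show ?thesis by (simp add: inner_commute)
  qed
  have norm_y: "norm y \<le> K"
  proof (cases "y = 0")
    case False
    have "(\<lambda>n. T (f n) \<bullet> y) \<longlonglongrightarrow> y \<bullet> y" "(\<lambda>n. K * norm (T (f n))) \<longlonglongrightarrow> K * norm y"
      by (intro tendsto_intros y)+
    moreover have "T (f n) \<bullet> y \<le> K * norm (T (f n))" for n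
      using K[of "f n"] eq[of "f n"] by simp
    ultimately have "y \<bullet> y \<le> K * norm y" by (intro LIMSEQ_le) auto
    then show ?thesis using False by (simp add: dot_square_norm power2_eq_square)
  qed (use \<open>0 \<le> K\<close> in simp)
  \<comment> \<open>This pins \<open>y\<close> down among all representing vectors; Douglas' lemma
    derives the linearity of its factor from it.\<close>
  have "y \<in> closure (range T)"
    unfolding closure_sequential
    by (rule exI[of _ "\<lambda>n. T (f n)"], intro conjI allI rangeI y)
  then show thesis by (rule that[OF _ eq norm_y])
qed

section \<open>Square roots of positive operators\<close>

text \<open>The Taylor coefficients of \<open>\<surd>(1 - x)\<close>.\<close>

abbreviation "sqrt_coeff n \<equiv> (-1) ^ n * ((1/2::real) gchoose n)"

text \<open>In the rising factorial of \<open>-1/2\<close> only the first factor is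
  negative.\<close>

lemma sqrt_coeff_Suc: "sqrt_coeff (Suc n) \<le> 0"
proof -
  have "sqrt_coeff (Suc n) = pochhammer (- (1/2)) (Suc n) / fact (Suc n)"
    by (subst gbinomial_pochhammer) (simp flip: power_mult_distrib mult.assoc)
  also have "\<dots> = - (1/2) * pochhammer (1/2) n / fact (Suc n)"
    by (simp add: pochhammer_rec)
  also have "\<dots> \<le> 0" using pochhammer_nonneg[of "1/2::real" n]
    by (intro divide_nonpos_nonneg) auto
  finally show ?thesis .
qed

text \<open>Partial sums are the coefficients of \<open>sqrt (1 - x) / (1 - x)\<close>, that is of
  \<open>(1 - x)\<close> to the power \<open>-1/2\<close>, which are rising factorials of
  \<open>1/2\<close> over factorials.\<close>

lemma sum_sqrt_coeff_nonneg: "0 \<le> (\<Sum>k\<le>n. sqrt_coeff k)"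
proof -
  have "(\<Sum>k\<le>n. sqrt_coeff k) = (-1) ^ n * ((-1/2::real) gchoose n)"
    using gbinomial_sum_lower_neg[of "1/2::real" n] by (simp add: mult.commute)
  also have "\<dots> = pochhammer (1/2) n / fact n"
    by (subst gbinomial_pochhammer) (simp flip: power_mult_distrib mult.assoc)
  also have "\<dots> \<ge> 0" by (simp add: pochhammer_nonneg)
  finally show ?thesis .
qed

text \<open>After the constant term 1 no coefficient is positive, so the sum is 1 minus a partial
  sum of all coefficients. The bound yields absolute convergence and, being exactly 1, also
  positivity of the root.\<close>

lemma sum_abs_sqrt_coeff_Suc: "(\<Sum>k<n. \<bar>sqrt_coeff (Suc k)\<bar>) \<le> 1"
proof -
  have "(\<Sum>k<n. \<bar>sqrt_coeff (Suc k)\<bar>) = - (\<Sum>k<n. sqrt_coeff (Suc k))"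
    unfolding sum_negf[symmetric] by (intro sum.cong refl abs_of_nonpos sqrt_coeff_Suc)
  also have "\<dots> = 1 - (\<Sum>k\<le>n. sqrt_coeff k)"
    by (subst lessThan_Suc_atMost[symmetric], subst sum.lessThan_Suc_shift) simp
  finally show ?thesis using sum_sqrt_coeff_nonneg[of n] by linarith
qed

lemma summable_abs_sqrt_coeff: "summable (\<lambda>n. \<bar>sqrt_coeff n\<bar>)"
  by (subst summable_Suc_iff[symmetric], intro bounded_imp_summable[where B = 1])
     (use sum_abs_sqrt_coeff_Suc[of "Suc _"] in \<open>auto simp: lessThan_Suc_atMost\<close>)

lemma suminf_abs_sqrt_coeff_Suc: "(\<Sum>n. \<bar>sqrt_coeff (Suc n)\<bar>) \<le> 1"
  using summable_abs_sqrt_coeff sum_abs_sqrt_coeff_Suc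
  by (intro suminf_le_const) (simp_all only: summable_Suc_iff[of "\<lambda>n. \<bar>sqrt_coeff n\<bar>"])

text \<open>These are the coefficients of the squared series, hence of \<open>1 - x\<close>:
  Vandermonde's identity turns them into binomials over \<open>1/2 + 1/2 = 1\<close>.\<close>

lemma sqrt_coeff_convolution:
  "(\<Sum>i\<le>k. sqrt_coeff i * sqrt_coeff (k - i)) = (if k = 0 then 1 else if k = 1 then -1 else 0)"
proof -
  have "(\<Sum>i\<le>k. sqrt_coeff i * sqrt_coeff (k - i))
      = (\<Sum>i\<le>k. (-1) ^ k * (((1/2) gchoose i) * ((1/2) gchoose (k - i))))"
    by (intro sum.cong refl) (simp add: mult_ac flip: power_add)
  also have "\<dots> = (-1) ^ k * ((1::real) gchoose k)"
    using gbinomial_Vandermonde[of "1/2::real" "1/2" k]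
    by (simp add: atMost_atLeast0 flip: sum_distrib_left)
  also have "(1::real) gchoose k = of_nat (1 choose k)"
    using binomial_gbinomial[of 1 k, where 'a = real] by simp
  finally show ?thesis by (cases k) (auto simp: binomial_eq_0)
qed

text \<open>The real counterpart of \<open>positive_op\<close>. Symmetry is demanded explicitly
  because a nonnegative real quadratic form does not imply it.\<close>

definition sym_nonneg :: "('a::real_inner \<Rightarrow> 'a) \<Rightarrow> bool" where
  "sym_nonneg T \<longleftrightarrow> bounded_linear T \<and> (\<forall>x y. T x \<bullet> y = x \<bullet> T y) \<and> (\<forall>x. 0 \<le> T x \<bullet> x)"

lemma sym_nonnegD:
  assumes "sym_nonneg T"
  shows "bounded_linear T" "T x \<bullet> y = x \<bullet> T y" "0 \<le> T x \<bullet> x"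
  using assms unfolding sym_nonneg_def by blast+

text \<open>The form at \<open>x + t *\<^sub>R T x\<close> is nonnegative with constant term 0, so
  its linear coefficient, twice the squared norm of \<open>T x\<close>, vanishes.\<close>

lemma sym_nonneg_kernel:
  assumes T: "sym_nonneg T" and "T x \<bullet> x = 0"
  shows "T x = 0"
proof -
  interpret T: bounded_linear T by (rule sym_nonnegD[OF T])
  have "0 \<le> 2 * t * (T x \<bullet> T x) + t\<^sup>2 * (T (T x) \<bullet> T x)" for t
  proof -
    have "0 \<le> T (x + t *\<^sub>R T x) \<bullet> (x + t *\<^sub>R T x)" by (rule sym_nonnegD[OF T])
    also have "\<dots> = 2 * t * (T x \<bullet> T x) + t\<^sup>2 * (T (T x) \<bullet> T x)"
      using sym_nonnegD(2)[OF T, of "T x" x] \<open>T x \<bullet> x = 0\<close>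
      by (simp add: T.add T.scaleR inner_simps algebra_simps power2_eq_square)
    finally show ?thesis .
  qed
  then have "T x \<bullet> T x = 0" by (rule linear_coeff_eq_0_if_quadratic_nonneg)
  then show ?thesis by simp
qed

text \<open>Provides the contraction \<open>1 - D\<close> at which the binomial series is evaluated.
  Nonnegativity of the form at \<open>x - D x\<close> gives
  \<open>D x \<bullet> D x \<le> D x \<bullet> x\<close>, which absorbs the quadratic term of the
  expanded square.\<close>

lemma norm_diff_sym_nonneg_le:
  assumes D: "sym_nonneg D" and le: "\<And>x. norm (D x) \<le> norm x"
  shows "norm (x - D x) \<le> norm x"
proof -
  interpret D: bounded_linear D by (rule sym_nonnegD[OF D])
  have "0 \<le> D (x - D x) \<bullet> (x - D x)" by (rule sym_nonnegD[OF D])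
  also have "\<dots> = D x \<bullet> x - 2 * (D x \<bullet> D x) + D (D x) \<bullet> D x"
    using sym_nonnegD(2)[OF D, of "D x" x] by (simp add: D.diff inner_simps algebra_simps)
  also have "D (D x) \<bullet> D x \<le> D x \<bullet> D x"
    using norm_cauchy_schwarz[of "D (D x)" "D x"] mult_right_mono[OF le[of "D x"], of "norm (D x)"]
    by (simp add: power2_norm_eq_inner[symmetric] power2_eq_square)
  finally have "(norm (x - D x))\<^sup>2 \<le> (norm x)\<^sup>2"
    using sym_nonnegD(3)[OF D, of x] by (simp add: power2_norm_eq_inner inner_simps inner_commute)
  then show ?thesis by (simp add: abs_le_square_iff[symmetric])
qed

section \<open>The binomial series at a contraction\<close>

locale contraction =
  fixes A :: "'a::{real_inner,banach} \<Rightarrow> 'a"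
  assumes bounded_linear_contraction: "bounded_linear A" and contr: "norm (A x) \<le> norm x"
begin

lemma norm_funpow_le: "norm ((A ^^ n) x) \<le> norm x"
  by (induction n) (auto intro: order_trans[OF contr])

lemma bounded_linear_funpow: "bounded_linear (A ^^ n)"
proof (induction n)
  case 0
  then show ?case by (simp add: bounded_linear_ident id_def)
next
  case (Suc n)
  then show ?case using bounded_linear_compose[OF bounded_linear_contraction Suc] by (simp add: o_def)
qed

text \<open>A square root of \<open>1 - A\<close>. A contraction may have norm 1, the boundary of
  the disc of convergence, where absolute summability of the coefficients still gives
  convergence.\<close>

definition sqrt_diff :: "'a \<Rightarrow> 'a" where
  "sqrt_diff x = (\<Sum>n. sqrt_coeff n *\<^sub>R (A ^^ n) x)"

lemma norm_term_le: "norm (sqrt_coeff n *\<^sub>R (A ^^ n) x) \<le> \<bar>sqrt_coeff n\<bar> * norm x"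
  unfolding norm_scaleR by (intro mult_left_mono norm_funpow_le) simp

lemma summable_norm_term: "summable (\<lambda>n. norm (sqrt_coeff n *\<^sub>R (A ^^ n) x))"
  by (rule summable_comparison_test'[OF summable_mult2[OF summable_abs_sqrt_coeff, of "norm x"], where N = 0])
     (use norm_term_le in simp)

lemma sums_sqrt_diff: "(\<lambda>n. sqrt_coeff n *\<^sub>R (A ^^ n) x) sums sqrt_diff x"
  unfolding sqrt_diff_def using summable_norm_cancel[OF summable_norm_term] by (rule summable_sums)

lemma has_sum_sqrt_diff: "((\<lambda>n. sqrt_coeff n *\<^sub>R (A ^^ n) x) has_sum sqrt_diff x) UNIV"
  using summable_norm_term sums_sqrt_diff by (rule norm_summable_imp_has_sum)

lemma bounded_linear_sqrt_diff: "bounded_linear sqrt_diff"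
proof (rule bounded_linear_intro)
  fix x y :: 'a and r :: real
  interpret p: bounded_linear "A ^^ n" for n by (rule bounded_linear_funpow)
  show "sqrt_diff (x + y) = sqrt_diff x + sqrt_diff y"
    using sums_add[OF sums_sqrt_diff[of x] sums_sqrt_diff[of y]] sums_sqrt_diff[of "x + y"]
    by (simp add: p.add scaleR_add_right sums_unique2)
  show "sqrt_diff (r *\<^sub>R x) = r *\<^sub>R sqrt_diff x"
    using sums_scaleR_right[OF sums_sqrt_diff[of x], of r] sums_sqrt_diff[of "r *\<^sub>R x"]
    by (simp add: p.scaleR mult.commute sums_unique2)
  have "norm (sqrt_diff x) \<le> (\<Sum>n. norm (sqrt_coeff n *\<^sub>R (A ^^ n) x))"
    unfolding sqrt_diff_def by (rule summable_norm[OF summable_norm_term])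
  also have "\<dots> \<le> (\<Sum>n. \<bar>sqrt_coeff n\<bar> * norm x)"
    by (intro suminf_le norm_term_le summable_norm_term summable_mult2 summable_abs_sqrt_coeff)
  also have "\<dots> = norm x * (\<Sum>n. \<bar>sqrt_coeff n\<bar>)"
    by (subst suminf_mult2[symmetric, OF summable_abs_sqrt_coeff]) (rule mult.commute)
  finally show "norm (sqrt_diff x) \<le> norm x * (\<Sum>n. \<bar>sqrt_coeff n\<bar>)" .
qed

text \<open>\<open>B\<close> commutes with every power of \<open>A\<close> and, being continuous,
  passes through the series. This later gives uniqueness of roots and, with \<open>B\<close> a
  complex scalar, their complex linearity.\<close>

lemma sqrt_diff_commute:
  assumes B: "bounded_linear B" and BA: "\<And>x. B (A x) = A (B x)"
  shows "B (sqrt_diff x) = sqrt_diff (B x)"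
proof -
  interpret B: bounded_linear B by (rule B)
  have "B ((A ^^ n) x) = (A ^^ n) (B x)" for n by (induction n) (simp_all add: BA)
  then show ?thesis
    using B.sums[OF sums_sqrt_diff[of x]] sums_sqrt_diff[of "B x"]
    by (simp add: B.scaleR sums_unique2)
qed

text \<open>Cauchy product: the double family \<open>g\<close> is absolutely summable, so its sum by
  rows, the left side, equals its sum by diagonals, which the convolution identity
  evaluates.\<close>

lemma sqrt_diff_sqrt_diff: "sqrt_diff (sqrt_diff x) = x - A x"
proof -
  interpret S: bounded_linear sqrt_diff by (rule bounded_linear_sqrt_diff)
  interpret p: bounded_linear "A ^^ n" for n by (rule bounded_linear_funpow)
  define g where "g = (\<lambda>(i, j). (sqrt_coeff i * sqrt_coeff j) *\<^sub>R (A ^^ (i + j)) x)"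
  have row: "((\<lambda>j. g (i, j)) has_sum (sqrt_coeff i *\<^sub>R (A ^^ i) (sqrt_diff x))) UNIV" for i
    using has_sum_bounded_linear[OF bounded_linear_compose[OF bounded_linear_scaleR_right bounded_linear_funpow]
        has_sum_sqrt_diff, of "sqrt_coeff i" i x]
    by (simp add: g_def p.scaleR funpow_add)
  have "(\<lambda>p. norm (g p)) summable_on UNIV \<times> UNIV"
  proof (intro Infinite_Sum.abs_summable_on_Sigma_iff[THEN iffD2] conjI ballI)
    have coeff: "(\<lambda>j. \<bar>sqrt_coeff j\<bar>) summable_on UNIV"
      using summable_abs_sqrt_coeff by (intro norm_summable_imp_summable_on) simp
    have le: "norm (g (i, j)) \<le> \<bar>sqrt_coeff i\<bar> * (\<bar>sqrt_coeff j\<bar> * norm x)" for i j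
      unfolding g_def by (simp add: abs_mult mult.assoc mult_left_mono norm_funpow_le)
    have sum: "(\<lambda>j. \<bar>sqrt_coeff i\<bar> * (\<bar>sqrt_coeff j\<bar> * norm x)) summable_on UNIV" for i
      by (intro summable_on_cmult_left summable_on_cmult_right coeff)
    show rows: "(\<lambda>j. norm (g (i, j))) summable_on UNIV" for i
      using sum le by (rule Infinite_Sum.abs_summable_on_comparison_test')
    show "(\<lambda>i. norm (\<Sum>\<^sub>\<infinity>j. norm (g (i, j)))) summable_on UNIV"
    proof (rule Infinite_Sum.abs_summable_on_comparison_test')
      let ?c = "(\<Sum>\<^sub>\<infinity>j. \<bar>sqrt_coeff j\<bar> * norm x)"
      show "(\<lambda>i. \<bar>sqrt_coeff i\<bar> * ?c) summable_on UNIV"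
        by (intro summable_on_cmult_left coeff)
      have "(\<Sum>\<^sub>\<infinity>j. norm (g (i, j))) \<le> (\<Sum>\<^sub>\<infinity>j. \<bar>sqrt_coeff i\<bar> * (\<bar>sqrt_coeff j\<bar> * norm x))" for i
        by (intro infsum_mono rows sum le)
      also have "(\<Sum>\<^sub>\<infinity>j. \<bar>sqrt_coeff i\<bar> * (\<bar>sqrt_coeff j\<bar> * norm x)) = \<bar>sqrt_coeff i\<bar> * ?c" for i
        by (intro infsum_cmult_right summable_on_cmult_left coeff)
      finally show "norm (\<Sum>\<^sub>\<infinity>j. norm (g (i, j))) \<le> \<bar>sqrt_coeff i\<bar> * ?c" for i
        by (simp add: infsum_nonneg)
    qed
  qed
  then have "g summable_on UNIV \<times> UNIV" by (rule abs_summable_summable)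
  then obtain s where s: "(g has_sum s) (UNIV \<times> UNIV)" by (auto simp: summable_on_def)
  have "((\<lambda>i. sqrt_coeff i *\<^sub>R (A ^^ i) (sqrt_diff x)) has_sum s) UNIV"
    by (rule has_sum_SigmaD[OF s row])
  then have s1: "s = sqrt_diff (sqrt_diff x)"
    using has_sum_sqrt_diff has_sum_unique by blast
  \<comment> \<open>Regrouping by the total degree \<open>k = i + j\<close>; the index set has
    \<open>i \<le> k\<close>, so the truncated subtraction is exact.\<close>
  have "((\<lambda>(k, i). g (i, k - i)) has_sum s) (SIGMA k:UNIV. {..k})"
    using s by (subst has_sum_reindex_bij_witness[where i = "\<lambda>(i, j). (i + j, i)" and
          j = "\<lambda>(k, i). (i, k - i)" and T = "UNIV \<times> UNIV" and h = g and s' = s]) auto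
  then have "((\<lambda>k. \<Sum>i\<le>k. g (i, k - i)) has_sum s) UNIV"
    by (rule has_sum_SigmaD) simp
  moreover have "(\<Sum>i\<le>k. g (i, k - i)) = (if k = 0 then x else if k = 1 then - A x else 0)" for k
  proof -
    have "(\<Sum>i\<le>k. g (i, k - i)) = (\<Sum>i\<le>k. sqrt_coeff i * sqrt_coeff (k - i)) *\<^sub>R (A ^^ k) x"
      unfolding scaleR_sum_left by (intro sum.cong refl) (simp add: g_def)
    also have "\<dots> = (if k = 0 then x else if k = 1 then - A x else 0)"
      unfolding sqrt_coeff_convolution by simp
    finally show ?thesis .
  qed
  ultimately have "((\<lambda>k. if k = 0 then x else if k = 1 then - A x else 0) has_sum s) (UNIV::nat set)"
    by simp
  moreover have "((\<lambda>k. if k = 0 then x else if k = 1 then - A x else 0) has_sum (x - A x)) (UNIV::nat set)"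
    by (rule has_sum_finite_neutralI[where B = "{0, 1}"]) auto
  ultimately show ?thesis using has_sum_unique s1 by blast
qed

text \<open>Symmetry passes from \<open>A\<close> to its powers and to the series. For
  nonnegativity, the constant term contributes \<open>(norm x)\<^sup>2\<close>, and the others
  together at least its negative, as their coefficients sum to at most 1 in absolute value.\<close>

lemma sym_nonneg_sqrt_diff:
  assumes sym: "\<And>x y. A x \<bullet> y = x \<bullet> A y"
  shows "sym_nonneg sqrt_diff"
  unfolding sym_nonneg_def
proof (intro conjI allI)
  have sym_pow: "(A ^^ n) x \<bullet> y = x \<bullet> (A ^^ n) y" for n x y
    by (induction n arbitrary: x y) (simp_all add: sym funpow_swap1)
  have inner: "(\<lambda>n. sqrt_coeff n * ((A ^^ n) x \<bullet> y)) sums (sqrt_diff x \<bullet> y)" for x y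
    using bounded_linear.sums[OF bounded_linear_inner_left sums_sqrt_diff, of x y] by simp
  show "bounded_linear sqrt_diff" by (rule bounded_linear_sqrt_diff)
  show "sqrt_diff x \<bullet> y = x \<bullet> sqrt_diff y" for x y
  proof -
    have "(A ^^ n) y \<bullet> x = (A ^^ n) x \<bullet> y" for n by (metis sym_pow inner_commute)
    then show ?thesis
      using sums_unique2[OF inner[of x y]] inner[of y x] by (simp only: inner_commute[of x])
  qed
  show "0 \<le> sqrt_diff x \<bullet> x" for x
  proof -
    have bd: "- (\<bar>sqrt_coeff (Suc n)\<bar> * (norm x)\<^sup>2) \<le> sqrt_coeff (Suc n) * ((A ^^ Suc n) x \<bullet> x)" for n
    proof -
      have "\<bar>(A ^^ Suc n) x \<bullet> x\<bar> \<le> norm ((A ^^ Suc n) x) * norm x" by (rule Cauchy_Schwarz_ineq2)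
      also have "\<dots> \<le> (norm x)\<^sup>2"
        unfolding power2_eq_square by (intro mult_right_mono norm_funpow_le) simp
      finally have "\<bar>sqrt_coeff (Suc n) * ((A ^^ Suc n) x \<bullet> x)\<bar> \<le> \<bar>sqrt_coeff (Suc n)\<bar> * (norm x)\<^sup>2"
        unfolding abs_mult by (intro mult_left_mono) auto
      then show ?thesis by linarith
    qed
    have right: "(\<lambda>n. sqrt_coeff (Suc n) * ((A ^^ Suc n) x \<bullet> x)) sums (sqrt_diff x \<bullet> x - (norm x)\<^sup>2)"
      using inner[of x x] by (subst sums_Suc_iff) (simp add: power2_norm_eq_inner)
    have left: "(\<lambda>n. - (\<bar>sqrt_coeff (Suc n)\<bar> * (norm x)\<^sup>2)) sums
        - ((\<Sum>n. \<bar>sqrt_coeff (Suc n)\<bar>) * (norm x)\<^sup>2)"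
      using summable_abs_sqrt_coeff
      by (intro sums_minus sums_mult2 summable_sums) (simp only: summable_Suc_iff[of "\<lambda>n. \<bar>sqrt_coeff n\<bar>"])
    have "- ((\<Sum>n. \<bar>sqrt_coeff (Suc n)\<bar>) * (norm x)\<^sup>2) \<le> sqrt_diff x \<bullet> x - (norm x)\<^sup>2"
      by (rule sums_le[OF bd left right])
    moreover have "(\<Sum>n. \<bar>sqrt_coeff (Suc n)\<bar>) * (norm x)\<^sup>2 \<le> 1 * (norm x)\<^sup>2"
      by (intro mult_right_mono suminf_abs_sqrt_coeff_Suc) simp
    ultimately show ?thesis by linarith
  qed
qed

end

section \<open>Existence and uniqueness of the nonnegative root\<close>

lemma sym_nonneg_scaleR: "sym_nonneg T \<Longrightarrow> 0 \<le> c \<Longrightarrow> sym_nonneg (\<lambda>x. c *\<^sub>R T x)"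
  by (auto simp: sym_nonneg_def intro: bounded_linear_compose[OF bounded_linear_scaleR_right])

text \<open>Dividing by a bound \<open>K > 0\<close> gives \<open>E\<close> of norm at most 1; the
  series at \<open>1 - E\<close> squares to \<open>E\<close>, and the factor \<open>sqrt K\<close>
  undoes the scaling.\<close>

lemma sym_nonneg_sqrt_exists:
  fixes D :: "'a::{real_inner,banach} \<Rightarrow> 'a"
  assumes D: "sym_nonneg D"
  obtains S where "sym_nonneg S" "S \<circ> S = D"
    "\<And>B. bounded_linear B \<Longrightarrow> B \<circ> D = D \<circ> B \<Longrightarrow> B \<circ> S = S \<circ> B"
proof -
  have lin: "bounded_linear D" by (rule sym_nonnegD[OF D])
  obtain K where K: "0 < K" "\<And>x. norm (D x) \<le> norm x * K"
    using bounded_linear.pos_bounded[OF lin] by auto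
  define E where "E x = (1 / K) *\<^sub>R D x" for x
  have E: "sym_nonneg E" unfolding E_def using D K by (intro sym_nonneg_scaleR) auto
  have E_le: "norm (E x) \<le> norm x" for x using K by (simp add: E_def field_simps)
  interpret contraction "\<lambda>x. x - E x"
    by (rule contraction.intro)
       (use norm_diff_sym_nonneg_le[OF E E_le] bounded_linear_sub[OF bounded_linear_ident sym_nonnegD(1)[OF E]] in auto)
  have S: "sym_nonneg sqrt_diff"
    using sym_nonnegD(2)[OF E] by (intro sym_nonneg_sqrt_diff) (simp add: inner_diff_left inner_diff_right)
  show thesis
  proof
    show "sym_nonneg (\<lambda>x. sqrt K *\<^sub>R sqrt_diff x)" using S K by (intro sym_nonneg_scaleR) auto
    show "(\<lambda>x. sqrt K *\<^sub>R sqrt_diff x) \<circ> (\<lambda>x. sqrt K *\<^sub>R sqrt_diff x) = D"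
    proof
      fix x
      have "sqrt K *\<^sub>R sqrt_diff (sqrt K *\<^sub>R sqrt_diff x) = K *\<^sub>R sqrt_diff (sqrt_diff x)"
        using K by (simp add: linear_scale[OF bounded_linear.linear[OF bounded_linear_sqrt_diff]])
      also have "\<dots> = K *\<^sub>R E x" unfolding sqrt_diff_sqrt_diff by simp
      finally show "((\<lambda>x. sqrt K *\<^sub>R sqrt_diff x) \<circ> (\<lambda>x. sqrt K *\<^sub>R sqrt_diff x)) x = D x"
        using K by (simp add: E_def)
    qed
    fix B assume B: "bounded_linear B" "B \<circ> D = D \<circ> B"
    interpret B: bounded_linear B by (rule B)
    have "B (x - E x) = B x - E (B x)" for x
      using B(2) by (simp add: B.scaleR B.diff E_def fun_eq_iff)
    then show "B \<circ> (\<lambda>x. sqrt K *\<^sub>R sqrt_diff x) = (\<lambda>x. sqrt K *\<^sub>R sqrt_diff x) \<circ> B"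
      using sqrt_diff_commute[OF B(1)] by (auto simp: B.scaleR)
  qed
qed

text \<open>
  The constructed root \<open>R\<close> commutes with every other root \<open>V\<close>, since \<open>V\<close> commutes with \<open>V\<^sup>2 = D\<close>.
  For commuting roots, \<open>(R + V) (R - V) = 0\<close>.
\<close>

lemma sym_nonneg_sqrt_unique:
  fixes D :: "'a::{real_inner,banach} \<Rightarrow> 'a"
  assumes S: "sym_nonneg S" "S \<circ> S = D" and T: "sym_nonneg T" "T \<circ> T = D"
  shows "S = T"
proof -
  have main: "R = T" if R: "sym_nonneg R" "R \<circ> R = D" and T: "sym_nonneg T" "T \<circ> T = D"
    and comm: "T \<circ> R = R \<circ> T" for R T
  proof
    fix x
    interpret R: bounded_linear R by (rule sym_nonnegD[OF R(1)])
    interpret T: bounded_linear T by (rule sym_nonnegD[OF T(1)])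
    define y where "y = R x - T x"
    have eq: "R (R z) = T (T z)" "T (R z) = R (T z)" for z
      using R T comm by (auto simp: fun_eq_iff)
    have "R y + T y = 0" by (simp add: y_def R.diff T.diff eq)
    \<comment> \<open>Both summands are nonnegative, so both vanish, and with them
      \<open>R y\<close> and \<open>T y\<close>. Symmetry moves \<open>R\<close> and
      \<open>T\<close> onto \<open>y\<close>, which makes \<open>y\<close> orthogonal to
      itself.\<close>
    then have "R y \<bullet> y + T y \<bullet> y = 0" by (simp flip: inner_add_left)
    then have "R y \<bullet> y = 0" "T y \<bullet> y = 0" using R T by (smt (verit) sym_nonneg_def)+
    then have "R y = 0" "T y = 0" using R T sym_nonneg_kernel by blast+
    then have "(R x - T x) \<bullet> y = 0"
      using sym_nonnegD(2)[OF R(1), of x y] sym_nonnegD(2)[OF T(1), of x y]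
      by (simp add: inner_diff_left)
    then show "R x = T x" by (simp add: y_def)
  qed
  have "sym_nonneg D"
    unfolding S(2)[symmetric] sym_nonneg_def o_def
    using sym_nonnegD[OF S(1)] by (metis bounded_linear_compose inner_ge_zero)
  then obtain R where R: "sym_nonneg R" "R \<circ> R = D"
    and comm: "\<And>B. bounded_linear B \<Longrightarrow> B \<circ> D = D \<circ> B \<Longrightarrow> B \<circ> R = R \<circ> B"
    using sym_nonneg_sqrt_exists by blast
  have "R = V" if "sym_nonneg V" "V \<circ> V = D" for V
  proof (rule main[OF R that])
    show "V \<circ> R = R \<circ> V"
      using that sym_nonnegD(1) by (intro comm) (auto simp: o_assoc)
  qed
  then show ?thesis using S T by metis
qed

section \<open>Positive operators on complex Hilbert spaces\<close>

text \<open>Multiplication by \<open>\<i>\<close> moves the imaginary part, up to sign, into the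
  real part, so the real inner product determines the complex one.\<close>

lemma cinner_conv_inner: "cinner x y = Complex (x \<bullet> y) (- ((\<i> *\<^sub>C x) \<bullet> y))"
  by (simp add: complex_eq_iff inner_eq_Re_cinner cinner_scaleC_left)

lemma inner_scaleC_left: "(c *\<^sub>C x) \<bullet> (y::'a::complex_inner) = x \<bullet> (cnj c *\<^sub>C y)"
proof -
  have "cinner x (cnj c *\<^sub>C y) = c * cnj (cinner y x)"
    by (subst cinner_commute) (simp add: cinner_scaleC_left)
  then have "cinner (c *\<^sub>C x) y = cinner x (cnj c *\<^sub>C y)"
    by (simp add: cinner_scaleC_left flip: cinner_commute)
  then show ?thesis by (simp add: inner_eq_Re_cinner)
qed

lemma norm_scaleC: "norm (c *\<^sub>C (x::'a::complex_inner)) = cmod c * norm x"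
proof -
  have "(c *\<^sub>C x) \<bullet> (c *\<^sub>C x) = x \<bullet> ((cnj c * c) *\<^sub>C x)"
    by (simp add: inner_scaleC_left scaleC_scaleC)
  also have "(cnj c * c) *\<^sub>C x = (cmod c)\<^sup>2 *\<^sub>R x"
    by (simp add: scaleR_scaleC complex_norm_square mult.commute flip: of_real_power)
  finally have "(norm (c *\<^sub>C x))\<^sup>2 = (cmod c * norm x)\<^sup>2"
    by (simp add: power2_norm_eq_inner power_mult_distrib)
  then show ?thesis by (metis norm_ge_zero power2_eq_imp_eq mult_nonneg_nonneg)
qed

lemma bounded_linear_scaleC: "bounded_linear ((*\<^sub>C) c :: 'a::complex_inner \<Rightarrow> 'a)"
  by (rule bounded_linear_intro[where K = "cmod c"])
     (auto simp: scaleC_add_right scaleR_scaleC scaleC_scaleC mult.commute norm_scaleC)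

lemma bounded_clinearD:
  assumes "bounded_clinear T"
  shows "bounded_linear T" "T (c *\<^sub>C x) = c *\<^sub>C T x"
  using assms by (auto simp: bounded_clinear_def)

lemma bounded_clinear_comp: "bounded_clinear S \<Longrightarrow> bounded_clinear T \<Longrightarrow> bounded_clinear (S \<circ> T)"
  unfolding bounded_clinear_def o_def by (simp add: bounded_linear_compose)

lemma scaleC_diff_right: "c *\<^sub>C (x - y) = c *\<^sub>C x - c *\<^sub>C (y::'a::complex_inner)"
  by (rule linear_diff[OF bounded_linear.linear[OF bounded_linear_scaleC]])

text \<open>Polarization: the imaginary part of the form vanishes at \<open>x\<close>,
  \<open>\<i> *\<^sub>C y\<close> and their sum, so the mixed terms cancel, which is symmetry.
  Conversely, symmetry equates \<open>(\<i> *\<^sub>C T f) \<bullet> f\<close> with its own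
  negative.\<close>

lemma positive_op_iff: "positive_op T \<longleftrightarrow> bounded_clinear T \<and> sym_nonneg T"
proof
  assume T: "positive_op T"
  then have lin: "bounded_clinear T" and pos: "\<And>f. 0 \<le> T f \<bullet> f" and im: "\<And>f. (\<i> *\<^sub>C T f) \<bullet> f = 0"
    by (simp_all add: positive_op_def complex_nonneg_Reals_iff cinner_conv_inner)
  interpret bounded_linear T by (rule bounded_clinearD[OF lin])
  have "T x \<bullet> y = x \<bullet> T y" for x y
  proof -
    have ii: "\<i> *\<^sub>C \<i> *\<^sub>C z = - z" for z :: 'a
      using scaleR_scaleC[of "-1" z] by (simp add: scaleC_scaleC)
    have "0 = (\<i> *\<^sub>C T (x + \<i> *\<^sub>C y)) \<bullet> (x + \<i> *\<^sub>C y)" by (simp add: im)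
    also have "\<dots> = (\<i> *\<^sub>C T x) \<bullet> (\<i> *\<^sub>C y) + (\<i> *\<^sub>C \<i> *\<^sub>C T y) \<bullet> x"
      using im[of x] im[of "\<i> *\<^sub>C y"]
      by (simp add: add scaleC_add_right inner_add_left inner_add_right bounded_clinearD[OF lin])
    also have "(\<i> *\<^sub>C T x) \<bullet> (\<i> *\<^sub>C y) = T x \<bullet> y"
      by (simp add: inner_scaleC_left scaleC_scaleC scaleC_one)
    finally show ?thesis by (simp add: ii inner_commute)
  qed
  then show "bounded_clinear T \<and> sym_nonneg T"
    using lin pos bounded_linear_axioms by (simp add: sym_nonneg_def)
next
  assume T: "bounded_clinear T \<and> sym_nonneg T"
  have "(\<i> *\<^sub>C T f) \<bullet> f = 0" for f
  proof -
    have "(\<i> *\<^sub>C T f) \<bullet> f = T (\<i> *\<^sub>C f) \<bullet> f" using T by (simp add: bounded_clinearD)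
    also have "\<dots> = (\<i> *\<^sub>C f) \<bullet> T f" using T by (simp add: sym_nonnegD(2))
    also have "\<dots> = f \<bullet> (- (\<i> *\<^sub>C T f))"
      using scaleR_scaleC[of "-1" "\<i> *\<^sub>C T f"] by (simp add: inner_scaleC_left scaleC_scaleC)
    finally show ?thesis by (simp add: inner_commute)
  qed
  then show "positive_op T"
    using T by (simp add: positive_op_def complex_nonneg_Reals_iff cinner_conv_inner sym_nonnegD(3))
qed

text \<open>The real root commutes with whatever commutes with \<open>D\<close>, in particular with
  complex scalars, so it is complex linear. Uniqueness is inherited from the real case.\<close>

lemma op_sqrt:
  assumes D: "positive_op D"
  shows "positive_op (op_sqrt D)" "op_sqrt D \<circ> op_sqrt D = D"
proof -
  have "sym_nonneg D" using D by (simp add: positive_op_iff)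
  then obtain S where S: "sym_nonneg S" "S \<circ> S = D"
    and comm: "\<And>B. bounded_linear B \<Longrightarrow> B \<circ> D = D \<circ> B \<Longrightarrow> B \<circ> S = S \<circ> B"
    using sym_nonneg_sqrt_exists by blast
  have "(*\<^sub>C) c \<circ> S = S \<circ> (*\<^sub>C) c" for c
    using D by (intro comm bounded_linear_scaleC) (simp add: fun_eq_iff positive_op_def bounded_clinearD)
  then have "bounded_clinear S"
    using sym_nonnegD(1)[OF S(1)] by (simp add: bounded_clinear_def fun_eq_iff)
  then have "\<exists>!S. positive_op S \<and> S \<circ> S = D"
    using S sym_nonneg_sqrt_unique by (metis positive_op_iff)
  then have "positive_op (op_sqrt D) \<and> op_sqrt D \<circ> op_sqrt D = D"
    unfolding op_sqrt_def by (rule theI')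
  then show "positive_op (op_sqrt D)" "op_sqrt D \<circ> op_sqrt D = D" by auto
qed

section \<open>Adjoints\<close>

text \<open>The imaginary part of the complex identity is the real identity at
  \<open>\<i> *\<^sub>C x\<close>.\<close>

lemma cinner_adjoint_iff:
  assumes T: "bounded_clinear T"
  shows "(\<forall>x y. cinner (T x) y = cinner x (S y)) \<longleftrightarrow> (\<forall>x y. T x \<bullet> y = x \<bullet> S y)"
proof -
  have "cinner (T x) y = Complex (T x \<bullet> y) (- (T (\<i> *\<^sub>C x) \<bullet> y))" for x y
    by (simp add: cinner_conv_inner bounded_clinearD(2)[OF T])
  then show ?thesis by (simp add: cinner_conv_inner[of _ "S _"]) blast
qed

lemma cadjoint_eqI:
  assumes T: "bounded_clinear T" and S: "\<And>x y. T x \<bullet> y = x \<bullet> S y"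
  shows "cadjoint T = S"
  unfolding cadjoint_def cinner_adjoint_iff[OF T]
proof (rule the_equality)
  show "\<forall>x y. T x \<bullet> y = x \<bullet> S y" using S by blast
  show "S' = S" if "\<forall>x y. T x \<bullet> y = x \<bullet> S' y" for S'
    using that S by (metis ext vector_eq_rdot inner_commute)
qed

lemma cadjoint_inner:
  assumes T: "bounded_clinear T"
  shows "T x \<bullet> y = x \<bullet> cadjoint T y"
proof -
  interpret T: bounded_linear T by (rule bounded_clinearD[OF T])
  obtain K where K: "0 \<le> K" "\<And>x. norm (T x) \<le> norm x * K" using T.nonneg_bounded by blast
  have "\<exists>z. \<forall>x. T x \<bullet> y = x \<bullet> z" for y
  proof -
    have "\<bar>T x \<bullet> y\<bar> \<le> K * norm y * norm (id x)" for x
      using Cauchy_Schwarz_ineq2[of "T x" y] mult_right_mono[OF K(2)[of x], of "norm y"]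
      by (simp add: mult_ac)
    moreover have "linear (\<lambda>x. T x \<bullet> y)"
      by (intro bounded_linear.linear bounded_linear_compose[OF bounded_linear_inner_left]
          T.bounded_linear_axioms)
    \<comment> \<open>Along \<open>id\<close> the seminorm is the norm, so this is the classical
      Riesz theorem.\<close>
    ultimately obtain z where "\<And>x. id x \<bullet> z = T x \<bullet> y"
      using riesz_along_linear_map[of id "\<lambda>x. T x \<bullet> y" "K * norm y"] K(1) linear_id
      by (metis mult_nonneg_nonneg norm_ge_zero)
    then show ?thesis by (metis id_apply)
  qed
  then obtain S where S: "\<And>x y. T x \<bullet> y = x \<bullet> S y" by metis
  then show ?thesis using cadjoint_eqI[OF T S] by simp
qed

lemma bounded_clinear_of_adjoint_pair:
  fixes T S :: "'a::chilbert_space \<Rightarrow> 'a"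
  assumes T: "bounded_clinear T" and S: "\<And>x y. T x \<bullet> y = x \<bullet> S y"
  shows "bounded_clinear S"
proof -
  interpret T: bounded_linear T by (rule bounded_clinearD[OF T])
  obtain K where K: "0 \<le> K" "\<And>x. norm (T x) \<le> norm x * K" using T.nonneg_bounded by blast
  have ext: "u = v" if "\<And>x. x \<bullet> u = x \<bullet> v" for u v :: 'a
    using that by (metis vector_eq_rdot inner_commute)
  have "bounded_linear S"
  proof (rule bounded_linear_intro)
    show "S (x + y) = S x + S y" for x y by (rule ext) (simp add: S[symmetric] inner_add_right)
    show "S (r *\<^sub>R x) = r *\<^sub>R S x" for r x by (rule ext) (simp add: S[symmetric])
    show "norm (S x) \<le> norm x * K" for x
    proof -
      have "norm (S x) * norm (S x) = T (S x) \<bullet> x"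
        by (simp add: S power2_norm_eq_inner flip: power2_eq_square)
      also have "\<dots> \<le> norm (T (S x)) * norm x" by (rule norm_cauchy_schwarz)
      also have "\<dots> \<le> norm (S x) * K * norm x" by (intro mult_right_mono K) simp
      finally show ?thesis using K(1) by (cases "S x = 0") (simp_all add: mult_ac)
    qed
  qed
  moreover have "S (c *\<^sub>C x) = c *\<^sub>C S x" for c x
  proof (rule ext)
    fix z
    have "z \<bullet> c *\<^sub>C S x = (cnj c *\<^sub>C z) \<bullet> S x" by (simp add: inner_scaleC_left)
    then show "z \<bullet> S (c *\<^sub>C x) = z \<bullet> c *\<^sub>C S x"
      by (simp add: S[symmetric] bounded_clinearD(2)[OF T] inner_scaleC_left)
  qed
  ultimately show ?thesis by (simp add: bounded_clinear_def)
qed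

lemma bounded_clinear_cadjoint: "bounded_clinear T \<Longrightarrow> bounded_clinear (cadjoint T)"
  by (rule bounded_clinear_of_adjoint_pair[OF _ cadjoint_inner])

lemma cadjoint_inner_left: "bounded_clinear T \<Longrightarrow> cadjoint T x \<bullet> y = x \<bullet> T y"
  using cadjoint_inner[of T y x] by (simp add: inner_commute)

lemma sym_nonneg_comp_adjoint:
  assumes "bounded_linear S" "bounded_linear T" and adj: "\<And>x y. T x \<bullet> y = x \<bullet> S y"
  shows "sym_nonneg (S \<circ> T)"
  unfolding sym_nonneg_def o_def
proof (intro conjI allI)
  show "bounded_linear (\<lambda>x. S (T x))" using assms(1,2) by (rule bounded_linear_compose)
  have adj': "S u \<bullet> v = u \<bullet> T v" for u v using adj[of v u] by (simp add: inner_commute)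
  show "S (T x) \<bullet> y = x \<bullet> S (T y)" "0 \<le> S (T x) \<bullet> x" for x y
    by (simp_all add: adj' flip: adj)
qed

section \<open>Douglas' lemma, posinormality and hyponormality\<close>

text \<open>The functional \<open>f \<mapsto> cadjoint T f \<bullet> x\<close> is bounded by the
  seminorm \<open>norm (T f)\<close>, so some \<open>S x\<close> in the closed range of
  \<open>T\<close> represents it along \<open>T\<close>. The representing identity says that
  \<open>cadjoint T (S x) = T x\<close>.\<close>

lemma douglas_factor:
  fixes T :: "'a::chilbert_space \<Rightarrow> 'a"
  assumes T: "bounded_clinear T" and c: "0 \<le> c"
    and le: "\<And>f. norm (cadjoint T f) \<le> c * norm (T f)"
  obtains S where "bounded_clinear S" "cadjoint T \<circ> S = T"
proof -
  interpret T: bounded_linear T by (rule bounded_clinearD[OF T])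
  note T' = bounded_clinear_cadjoint[OF T]
  interpret T': bounded_linear "cadjoint T" by (rule bounded_clinearD[OF T'])
  let ?V = "closure (range T)"
  have "\<exists>y. y \<in> ?V \<and> (\<forall>f. T f \<bullet> y = cadjoint T f \<bullet> x) \<and> norm y \<le> c * norm x" for x
  proof -
    have "\<bar>cadjoint T f \<bullet> x\<bar> \<le> c * norm x * norm (T f)" for f
      using Cauchy_Schwarz_ineq2[of "cadjoint T f" x] mult_right_mono[OF le[of f], of "norm x"]
      by (simp add: mult_ac)
    then show ?thesis
      using riesz_along_linear_map[of T "\<lambda>f. cadjoint T f \<bullet> x" "c * norm x"] c
        T.linear bounded_linear_compose[OF bounded_linear_inner_left T'.bounded_linear_axioms]
      by (metis bounded_linear.linear mult_nonneg_nonneg norm_ge_zero)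
  qed
  then obtain S where S_in: "\<And>x. S x \<in> ?V" and S: "\<And>f x. T f \<bullet> S x = cadjoint T f \<bullet> x"
    and S_le: "\<And>x. norm (S x) \<le> c * norm x" by metis
  have S_perp: "z \<bullet> S x = 0" if "\<And>f. z \<bullet> T f = 0" for x z
  proof -
    have "?V \<subseteq> {v. z \<bullet> v = 0}"
      using that by (intro closure_minimal closed_Collect_eq continuous_intros) auto
    then show ?thesis using S_in by blast
  qed
  \<comment> \<open>\<open>perp\<close> encodes membership in the closure of the range by double
    orthogonality, a form that sums and scalar multiples inherit directly. Then \<open>y - z\<close>
    is orthogonal to the range, hence to itself.\<close>
  have unique: "y = z"
    if eq: "\<And>f. T f \<bullet> y = T f \<bullet> z" and perp: "\<And>v. (\<And>f. v \<bullet> T f = 0) \<Longrightarrow> v \<bullet> y = 0 \<and> v \<bullet> z = 0" for y z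
  proof -
    have "(y - z) \<bullet> y = 0 \<and> (y - z) \<bullet> z = 0"
      by (rule perp) (metis eq inner_commute inner_diff_left eq_iff_diff_eq_0)
    then have "(y - z) \<bullet> (y - z) = 0" by (simp only: inner_diff_right)
    then show ?thesis by simp
  qed
  have "bounded_linear S"
  proof (rule bounded_linear_intro)
    show "S (x + y) = S x + S y" for x y
      by (rule unique) (auto simp: S inner_add_right S_perp)
    show "S (r *\<^sub>R x) = r *\<^sub>R S x" for r x
      by (rule unique) (auto simp: S S_perp)
    show "norm (S x) \<le> norm x * c" for x using S_le by (simp add: mult.commute)
  qed
  moreover have "S (a *\<^sub>C x) = a *\<^sub>C S x" for a x
  proof (rule unique)
    fix f
    have "T f \<bullet> a *\<^sub>C S x = T (cnj a *\<^sub>C f) \<bullet> S x"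
      by (simp add: inner_scaleC_left bounded_clinearD(2)[OF T])
    also have "\<dots> = cadjoint T f \<bullet> a *\<^sub>C x"
      by (simp add: S bounded_clinearD(2)[OF T'] inner_scaleC_left)
    finally show "T f \<bullet> S (a *\<^sub>C x) = T f \<bullet> a *\<^sub>C S x" by (simp add: S)
  next
    fix v assume v: "\<And>f. v \<bullet> T f = 0"
    have "(cnj a *\<^sub>C v) \<bullet> T f = 0" for f
      using v[of "a *\<^sub>C f"] by (simp add: inner_scaleC_left bounded_clinearD(2)[OF T])
    then show "v \<bullet> S (a *\<^sub>C x) = 0 \<and> v \<bullet> a *\<^sub>C S x = 0"
      using S_perp[of "cnj a *\<^sub>C v" x] S_perp[OF v] by (simp add: inner_scaleC_left)
  qed
  ultimately have "bounded_clinear S" by (simp add: bounded_clinear_def)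
  moreover have "cadjoint T (S x) = T x" for x
    using S by (metis T cadjoint_inner cadjoint_inner_left inner_commute vector_eq_rdot)
  ultimately show thesis using that by (simp add: fun_eq_iff)
qed

lemma posinormalI:
  assumes T: "bounded_clinear T" and "0 \<le> c" and "\<And>f. norm (cadjoint T f) \<le> c * norm (T f)"
  shows "posinormal T"
proof -
  obtain S where S: "bounded_clinear S" "cadjoint T \<circ> S = T"
    using douglas_factor[OF assms] by blast
  note S' = bounded_clinear_cadjoint[OF S(1)]
  \<comment> \<open>The adjoint of the factorization
    \<open>cadjoint T \<circ> S = T\<close>.\<close>
  have "cadjoint S (T f) = cadjoint T f" for f
  proof -
    have "cadjoint S (T f) \<bullet> x = cadjoint T f \<bullet> x" for x
    proof -
      have "cadjoint S (T f) \<bullet> x = f \<bullet> cadjoint T (S x)"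
        using S T by (simp add: cadjoint_inner_left cadjoint_inner)
      also have "\<dots> = cadjoint T f \<bullet> x" using S T by (simp add: fun_eq_iff cadjoint_inner_left)
      finally show ?thesis .
    qed
    then show ?thesis by (metis vector_eq_rdot inner_commute)
  qed
  then have "T \<circ> cadjoint T = cadjoint T \<circ> (S \<circ> cadjoint S) \<circ> T"
    using S(2) by (simp add: fun_eq_iff)
  moreover have "positive_op (S \<circ> cadjoint S)"
    using S(1) S' unfolding positive_op_iff
    by (intro conjI bounded_clinear_comp sym_nonneg_comp_adjoint) (auto simp: bounded_clinearD cadjoint_inner_left)
  ultimately show ?thesis using T unfolding posinormal_def by blast
qed

lemma hyponormalI:
  assumes T: "bounded_clinear T" and le: "\<And>f. norm (cadjoint T f) \<le> norm (T f)"
  shows "hyponormal T"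
proof -
  note T' = bounded_clinear_cadjoint[OF T]
  note comp = bounded_clinear_comp[OF T' T] bounded_clinear_comp[OF T T']
  have "(cadjoint T (T f) - T (cadjoint T f)) \<bullet> f = (norm (T f))\<^sup>2 - (norm (cadjoint T f))\<^sup>2" for f
    by (simp add: inner_diff_left cadjoint_inner_left[OF T] cadjoint_inner[OF T] power2_norm_eq_inner)
  moreover have "(norm (cadjoint T f))\<^sup>2 \<le> (norm (T f))\<^sup>2" for f by (intro power_mono le) simp
  moreover have "bounded_linear (\<lambda>f. cadjoint T (T f) - T (cadjoint T f))"
    using bounded_linear_sub[OF comp[THEN bounded_clinearD(1)]] by simp
  ultimately have "positive_op (\<lambda>f. (cadjoint T \<circ> T) f - (T \<circ> cadjoint T) f)"
    using comp unfolding positive_op_iff sym_nonneg_def bounded_clinear_def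
    by (auto simp: inner_diff_left inner_diff_right cadjoint_inner_left[OF T] cadjoint_inner[OF T]
        scaleC_diff_right)
  then show ?thesis using T by (simp add: hyponormal_def op_ge_def)
qed

section \<open>The norm estimate for the conjugated operator\<close>

lemma op_ge_inner_le: "S \<succeq> T \<Longrightarrow> T x \<bullet> x \<le> S x \<bullet> x"
  using sym_nonnegD(3)[of "\<lambda>f. S f - T f" x] by (simp add: op_ge_def positive_op_iff inner_diff_left)

lemma norm_cadjoint_sqrt_conjugate_le:
  assumes A: "bounded_clinear A" and pair: "A \<circ> Q \<circ> cadjoint A = cadjoint A \<circ> P \<circ> A"
    and D: "positive_op D" and \<delta>: "\<delta>\<^sub>1 > 0" "\<delta>\<^sub>2 > 0"
    and ge: "(\<lambda>f. \<delta>\<^sub>1 *\<^sub>R Q f) \<succeq> D" "D \<succeq> (\<lambda>f. \<delta>\<^sub>2 *\<^sub>R P f)"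
  defines "T \<equiv> op_sqrt D \<circ> A \<circ> op_sqrt D"
  shows "bounded_clinear T" "norm (cadjoint T f) \<le> sqrt (\<delta>\<^sub>1 / \<delta>\<^sub>2) * norm (T f)"
proof -
  define B where "B = op_sqrt D"
  have B: "bounded_clinear B" and sym: "\<And>x y. B x \<bullet> y = x \<bullet> B y" and BB: "\<And>x. B (B x) = D x"
    using op_sqrt[OF D] by (auto simp: B_def positive_op_iff sym_nonnegD(2) fun_eq_iff)
  show T: "bounded_clinear T" unfolding T_def B_def[symmetric] by (intro bounded_clinear_comp A B)
  have T': "cadjoint T = B \<circ> cadjoint A \<circ> B"
    by (rule cadjoint_eqI[OF T]) (simp add: T_def B_def[symmetric] sym cadjoint_inner[OF A])
  have normB: "(norm (B x))\<^sup>2 = D x \<bullet> x" for x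
    by (simp add: power2_norm_eq_inner BB flip: sym)
  \<comment> \<open>The upper bound on \<open>D\<close> is used at \<open>?h\<close> and the lower
    one at \<open>A ?g\<close>; the interrupter identity, tested at \<open>?g\<close>, connects
    them.\<close>
  let ?g = "B f" and ?h = "cadjoint A (B f)"
  have "(norm (cadjoint T f))\<^sup>2 = D ?h \<bullet> ?h" by (simp add: T' normB)
  also have "\<dots> \<le> \<delta>\<^sub>1 * (Q ?h \<bullet> ?h)" using op_ge_inner_le[OF ge(1), of ?h] by simp
  also have "Q ?h \<bullet> ?h = A (Q (cadjoint A ?g)) \<bullet> ?g" by (simp add: cadjoint_inner[OF A])
  also have "\<dots> = cadjoint A (P (A ?g)) \<bullet> ?g" using pair by (simp add: fun_eq_iff)
  also have "\<dots> = (1 / \<delta>\<^sub>2) * (\<delta>\<^sub>2 * (P (A ?g) \<bullet> A ?g))" using \<delta> by (simp add: cadjoint_inner_left[OF A])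
  also have "\<delta>\<^sub>1 * \<dots> \<le> \<delta>\<^sub>1 * ((1 / \<delta>\<^sub>2) * (D (A ?g) \<bullet> A ?g))"
    using op_ge_inner_le[OF ge(2), of "A ?g"] \<delta> by (intro mult_left_mono) auto
  also have "\<dots> = (sqrt (\<delta>\<^sub>1 / \<delta>\<^sub>2) * norm (T f))\<^sup>2"
    using \<delta> by (simp add: power_mult_distrib T_def B_def[symmetric] normB)
  finally show "norm (cadjoint T f) \<le> sqrt (\<delta>\<^sub>1 / \<delta>\<^sub>2) * norm (T f)"
    using \<delta> by (elim power2_le_imp_le) simp
qed

theorem theorem4:
  fixes A P Q D :: "'a::chilbert_space \<Rightarrow> 'a"
  assumes "supraposinormal A" and "interrupter_pair A Q P" and "positive_op D"
  shows
    "((\<exists>\<delta>\<^sub>1 \<delta>\<^sub>2 :: real. \<delta>\<^sub>1 > 0 \<and> \<delta>\<^sub>2 > 0 \<and>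
        (\<lambda>f. \<delta>\<^sub>1 *\<^sub>R Q f) \<succeq> D \<and> D \<succeq> (\<lambda>f. \<delta>\<^sub>2 *\<^sub>R P f) \<and> (\<lambda>f. \<delta>\<^sub>2 *\<^sub>R P f) \<succeq> (\<lambda>f. 0))
      \<longrightarrow> posinormal (op_sqrt D \<circ> A \<circ> op_sqrt D)) \<and>
     ((\<exists>\<delta>\<^sub>1 \<delta>\<^sub>2 :: real. \<delta>\<^sub>1 > 0 \<and> \<delta>\<^sub>2 > 0 \<and> \<delta>\<^sub>1 \<le> \<delta>\<^sub>2 \<and>
        (\<lambda>f. \<delta>\<^sub>1 *\<^sub>R Q f) \<succeq> D \<and> D \<succeq> (\<lambda>f. \<delta>\<^sub>2 *\<^sub>R P f) \<and> (\<lambda>f. \<delta>\<^sub>2 *\<^sub>R P f) \<succeq> (\<lambda>f. 0))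
      \<longrightarrow> hyponormal (op_sqrt D \<circ> A \<circ> op_sqrt D))"
proof -
  let ?T = "op_sqrt D \<circ> A \<circ> op_sqrt D"
  have A: "bounded_clinear A" and pair: "A \<circ> Q \<circ> cadjoint A = cadjoint A \<circ> P \<circ> A"
    using assms by (simp_all add: supraposinormal_def interrupter_pair_def)
  note bound = norm_cadjoint_sqrt_conjugate_le[OF A pair assms(3)]
  have "posinormal ?T"
    if "\<delta>\<^sub>1 > 0" "\<delta>\<^sub>2 > 0" "(\<lambda>f. \<delta>\<^sub>1 *\<^sub>R Q f) \<succeq> D" "D \<succeq> (\<lambda>f. \<delta>\<^sub>2 *\<^sub>R P f)" for \<delta>\<^sub>1 \<delta>\<^sub>2 :: real
    using bound[OF that] that(1,2) by (intro posinormalI[where c = "sqrt (\<delta>\<^sub>1 / \<delta>\<^sub>2)"]) auto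
  moreover have "hyponormal ?T"
    if \<delta>: "\<delta>\<^sub>1 > 0" "\<delta>\<^sub>2 > 0" "(\<lambda>f. \<delta>\<^sub>1 *\<^sub>R Q f) \<succeq> D" "D \<succeq> (\<lambda>f. \<delta>\<^sub>2 *\<^sub>R P f)" "\<delta>\<^sub>1 \<le> \<delta>\<^sub>2" for \<delta>\<^sub>1 \<delta>\<^sub>2 :: real
  proof (rule hyponormalI)
    show "bounded_clinear ?T" using bound(1)[OF \<delta>(1-4)] .
    \<comment> \<open>The order of the two constants brings the factor of the common estimate down
      to at most 1.\<close>
    have "sqrt (\<delta>\<^sub>1 / \<delta>\<^sub>2) \<le> 1" using \<delta> by simp
    then show "norm (cadjoint ?T f) \<le> norm (?T f)" for f
      using bound(2)[OF \<delta>(1-4), of f] mult_right_mono[of "sqrt (\<delta>\<^sub>1 / \<delta>\<^sub>2)" 1 "norm (?T f)"]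
      by simp
  qed
  ultimately show ?thesis by blast
qed

end
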